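(* Assume that for every prime $p$ and every squarefree $n \in \mathbb{N}$, the Dedekind zeta functions of the fields $\mathbb{Q}(\sqrt[n]{1}, \sqrt[n]{p})$ and $\mathbb{Q}(\sqrt[4n]{1}, \sqrt[4n]{p})$ satisfy the generalized Riemann hypothesis. Then for every prime $p$ the set \[ E(p) = \{ q \text{ prime} \mid X^q - 1 \text{ is reducible in } \mathbb{F}_p[X;M] \} \] is infinite. In particular, the monoid $M = \langle 2,3\rangle$ is not a Matsuda monoid of any positive type (that is, for no prime $p$ is $M$ a Matsuda monoid of type $p$).
   Context: $M = \langle 2,3\rangle = \mathbb{N}_0 \setminus \{1\}$ is the additive submonoid of $\mathbb{N}_0$ generated by $2$ and $3$. For a field $F$ and a commutative additive monoid $\Gamma$, $F[X;\Gamma]$ is the monoid ring of polynomials in $X$ with coefficients in $F$ and exponents in $\Gamma$. $F[X;M]$ is identified with the subring of $F[X]$ consisting of the polynomials whose coefficient of $X^1$ is zero. An element is called reducible if it is not a unit and not irreducible. $\Gamma$ is torsion-free if $n\alpha = n\beta$ with $n \in \mathbb{N}$, $\alpha,\beta\in\Gamma$ implies $\alpha=\beta$, and cancellative if $\alpha+\beta=\alpha+\gamma$ implies $\beta=\gamma$. An element $\pi \in \Gamma$ is indivisible if $nx = \pi$ with $n \in \mathbb{N}$ (positive) and $x \in \Gamma$ implies $n=1$ and $x = \pi$. A commutative, torsion-free, cancellative monoid $\Gamma$ is a Matsuda monoid of type $p$ (where $p \ge 0$ is a possible characteristic of a field) if for every field $F$ of characteristic $p$ and every indivisible $\pi \in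 \Gamma$, the element $X^{\pi} - 1$ is irreducible in $F[X;\Gamma]$. $\mathbb{Q}(\sqrt[m]{1},\sqrt[m]{p})$ is the field generated over $\mathbb{Q}$ by all $m$th roots of unity and all $m$th roots of $p$. *)

theory Defs
  imports
    "HOL-Complex_Analysis.Complex_Analysis"
    "HOL-Algebra.Algebraic_Closure_Type"
    "HOL-Algebra.Generated_Fields"
    "HOL-Number_Theory.Residues"
    "HOL-Computational_Algebra.Squarefree"
    "HOL-Library.Infinite_Typeclass"
begin

section \<open>Dedekind zeta functions and the generalized Riemann hypothesis\<close>

text \<open>
  Number fields are represented as subfields of the complex numbers, given by their carrier sets.
\<close>

definition radical_field :: "nat \<Rightarrow> nat \<Rightarrow> complex set" where
  "radical_field m a =
     generate_field ring_of_type_algebra (\<rat> \<union> {z. z ^ m = 1} \<union> {z. z ^ m = of_nat a})"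

definition ring_of_integers :: "complex set \<Rightarrow> complex ring" where
  "ring_of_integers K = ring_of_type_algebra \<lparr>carrier := {x \<in> K. algebraic_int x}\<rparr>"

definition nonzero_ideals :: "complex set \<Rightarrow> complex set set" where
  "nonzero_ideals K = {I. ideal I (ring_of_integers K) \<and> I \<noteq> {0}}"

definition ideal_norm :: "complex set \<Rightarrow> complex set \<Rightarrow> nat" where
  "ideal_norm K I = card (carrier (ring_of_integers K Quot I))"

definition dedekind_zeta_series :: "complex set \<Rightarrow> complex \<Rightarrow> complex" where
  "dedekind_zeta_series K s = (\<Sum>\<^sub>\<infinity>I\<in>nonzero_ideals K. of_nat (ideal_norm K I) powr (- s))"

definition zeta_continuation :: "complex set \<Rightarrow> (complex \<Rightarrow> complex) \<Rightarrow> bool" where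
  "zeta_continuation K Z \<longleftrightarrow>
     Z holomorphic_on - {1} \<and> (\<forall>s. Re s > 1 \<longrightarrow> Z s = dedekind_zeta_series K s)"

lemma zeta_continuation_unique:
  assumes "zeta_continuation K Z1" "zeta_continuation K Z2" "s \<noteq> 1"
  shows "Z1 s = Z2 s"
proof (rule analytic_continuation_open[of "{s. Re s > 1}" "- {1}" Z1 Z2 s])
  show "open {s. Re s > 1}" by (rule open_halfspace_Re_gt)
  have "(2::complex) \<in> {s. Re s > 1}" by simp
  then show "{s. Re s > 1} \<noteq> {}" by blast
  show "connected (- {1::complex})" by (rule connected_punctured_universe) simp
  show "{s. Re s > 1} \<subseteq> - {1}" by auto
  show "Z1 holomorphic_on - {1}" "Z2 holomorphic_on - {1}" "s \<in> - {1}"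
    using assms by (auto simp: zeta_continuation_def)
  show "Z1 z = Z2 z" if "z \<in> {s. Re s > 1}" for z
    using assms(1,2) that by (simp add: zeta_continuation_def)
qed auto

text \<open>
  By Hecke's theorem the Dedekind zeta function of a number field has a holomorphic continuation to
  the plane without the point 1, so the description below is satisfied. The continuation is unique
  up to its value at 1, which the Riemann hypothesis does not involve.
\<close>

definition dedekind_zeta :: "complex set \<Rightarrow> complex \<Rightarrow> complex" where
  "dedekind_zeta K = (SOME Z. zeta_continuation K Z)"

definition satisfies_GRH :: "(complex \<Rightarrow> complex) \<Rightarrow> bool" where
  "satisfies_GRH Z \<longleftrightarrow> (\<forall>s. 0 < Re s \<and> Re s < 1 \<and> Z s = 0 \<longrightarrow> Re s = 1 / 2)"


section \<open>Monoid rings\<close>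

text \<open>
  Commutative monoids are HOL-Algebra monoids. The exponent monoid is additive in the
  mathematics, so its addition is the record field \<open>mult\<close>, its neutral element is \<open>one\<close>,
  and the multiple of \<open>a\<close> by a natural number \<open>n\<close> is \<open>a [^] n\<close>.
  Elements of the monoid ring are coefficient functions, extended by zero outside
  the exponent monoid.
\<close>

definition monoid_ring ::
    "('a, 'm) ring_scheme \<Rightarrow> ('g, 'n) monoid_scheme \<Rightarrow> ('g \<Rightarrow> 'a) ring" where
  "monoid_ring F G =
     \<lparr>carrier = {f. range f \<subseteq> carrier F \<and> finite {a. f a \<noteq> \<zero>\<^bsub>F\<^esub>} \<and> {a. f a \<noteq> \<zero>\<^bsub>F\<^esub>} \<subseteq> carrier G},
      mult = (\<lambda>f g c. finsum F (\<lambda>(a, b). f a \<otimes>\<^bsub>F\<^esub> g b)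
        {(a, b). f a \<noteq> \<zero>\<^bsub>F\<^esub> \<and> g b \<noteq> \<zero>\<^bsub>F\<^esub> \<and> a \<otimes>\<^bsub>G\<^esub> b = c}),
      one = (\<lambda>a. if a = \<one>\<^bsub>G\<^esub> then \<one>\<^bsub>F\<^esub> else \<zero>\<^bsub>F\<^esub>),
      zero = (\<lambda>a. \<zero>\<^bsub>F\<^esub>),
      add = (\<lambda>f g a. f a \<oplus>\<^bsub>F\<^esub> g a)\<rparr>"

definition X_power :: "('a, 'm) ring_scheme \<Rightarrow> 'g \<Rightarrow> 'g \<Rightarrow> 'a" where
  "X_power F c = (\<lambda>a. if a = c then \<one>\<^bsub>F\<^esub> else \<zero>\<^bsub>F\<^esub>)"

definition X_power_minus_one ::
    "('a, 'm) ring_scheme \<Rightarrow> ('g, 'n) monoid_scheme \<Rightarrow> 'g \<Rightarrow> 'g \<Rightarrow> 'a" where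
  "X_power_minus_one F G c = X_power F c \<ominus>\<^bsub>monoid_ring F G\<^esub> \<one>\<^bsub>monoid_ring F G\<^esub>"

definition reducible :: "('a, 'm) ring_scheme \<Rightarrow> 'a \<Rightarrow> bool" where
  "reducible R x \<longleftrightarrow> x \<in> carrier R \<and> x \<notin> Units R \<and> \<not> ring_irreducible\<^bsub>R\<^esub> x"


section \<open>Matsuda monoids\<close>

definition torsion_free_monoid :: "('g, 'n) monoid_scheme \<Rightarrow> bool" where
  "torsion_free_monoid G \<longleftrightarrow>
     (\<forall>n::nat. \<forall>a\<in>carrier G. \<forall>b\<in>carrier G. n > 0 \<and> a [^]\<^bsub>G\<^esub> n = b [^]\<^bsub>G\<^esub> n \<longrightarrow> a = b)"

definition indivisible :: "('g, 'n) monoid_scheme \<Rightarrow> 'g \<Rightarrow> bool" where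
  "indivisible G c \<longleftrightarrow> c \<in> carrier G \<and>
     (\<forall>n::nat. \<forall>x\<in>carrier G. n > 0 \<and> x [^]\<^bsub>G\<^esub> n = c \<longrightarrow> n = 1 \<and> x = c)"

definition has_characteristic :: "('a, 'm) ring_scheme \<Rightarrow> nat \<Rightarrow> bool" where
  "has_characteristic F p \<longleftrightarrow> (\<forall>n::nat. [n] \<cdot>\<^bsub>F\<^esub> \<one>\<^bsub>F\<^esub> = \<zero>\<^bsub>F\<^esub> \<longleftrightarrow> p dvd n)"

text \<open>
  HOL cannot quantify over all fields of all types inside a formula. The first argument is the type
  from which the elements of the coefficient fields are drawn. For an infinite type the notion does
  not depend on this choice: a factorization involves only finitely many coefficients, so it
  descends to a countable subfield.
\<close>

definition matsuda_monoid :: "'k itself \<Rightarrow> nat \<Rightarrow> ('g, 'n) monoid_scheme \<Rightarrow> bool" where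
  "matsuda_monoid (_ :: 'k itself) p G \<longleftrightarrow>
     comm_monoid_cancel G \<and> torsion_free_monoid G \<and>
     (\<forall>F :: 'k ring. field F \<and> has_characteristic F p \<longrightarrow>
        (\<forall>c. indivisible G c \<longrightarrow> ring_irreducible\<^bsub>monoid_ring F G\<^esub> (X_power_minus_one F G c)))"


section \<open>The monoid generated by 2 and 3\<close>

definition monoid_2_3 :: "nat monoid" where
  "monoid_2_3 = \<lparr>carrier = {2 * a + 3 * b | a b. True}, mult = (+), one = 0\<rparr>"

lemma carrier_monoid_2_3: "carrier monoid_2_3 = - {1}"
proof -
  have "\<exists>a b. n = 2 * a + 3 * b" if "n \<noteq> 1" for n :: nat
  proof (cases "even n")
    case True
    then obtain k where "n = 2 * k" by (rule evenE)
    then show ?thesis by (intro exI[of _ k] exI[of _ 0]) simp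
  next
    case False
    with that have "n \<ge> 3" "even (n - 3)" by presburger+
    from \<open>even (n - 3)\<close> obtain k where "n - 3 = 2 * k" by (rule evenE)
    with \<open>n \<ge> 3\<close> show ?thesis by (intro exI[of _ k] exI[of _ 1]) simp
  qed
  moreover have "1 \<noteq> 2 * a + 3 * b" for a b :: nat by presburger
  ultimately have "{2 * a + 3 * b | a b. True} = - {1 :: nat}" by blast
  then show ?thesis by (simp add: monoid_2_3_def)
qed

lemma comm_monoid_cancel_monoid_2_3: "comm_monoid_cancel monoid_2_3"
proof (rule comm_monoid_cancelI)
  show "comm_monoid monoid_2_3"
    by (rule comm_monoidI) (unfold carrier_monoid_2_3, auto simp: monoid_2_3_def)
qed (auto simp: monoid_2_3_def)

lemma torsion_free_monoid_2_3: "torsion_free_monoid monoid_2_3"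
proof -
  have "a [^]\<^bsub>monoid_2_3\<^esub> n = n * a" for a n :: nat
    by (induction n) (simp_all add: nat_pow_def monoid_2_3_def)
  then show ?thesis by (auto simp: torsion_free_monoid_def)
qed

definition E :: "nat \<Rightarrow> nat set" where
  "E p = {q. Factorial_Ring.prime q \<and>
     reducible (monoid_ring (residue_ring (int p)) monoid_2_3)
       (X_power_minus_one (residue_ring (int p)) monoid_2_3 q)}"

end

theory Submission
  imports Defs "HOL-Number_Theory.Number_Theory"
begin

text \<open>
  Every prime \<open>q\<close> with \<open>4 p\<close> dividing \<open>q - 1\<close> belongs to \<open>E p\<close>, and by a cyclotomic argument there are
  infinitely many of them. Let \<open>T\<close> be the sum of the \<open>X\<^sup>n\<close> over the quadratic nonresidues \<open>n < q\<close>.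
  Evaluating a Jacobsthal sum gives \<open>T (T + 1) = 0\<close> in \<open>F\<^sub>p[X] / (X\<^sup>q - 1)\<close>, so \<open>X\<^sup>q - 1\<close> is the product of
  \<open>f = gcd (T, X\<^sup>q - 1)\<close> and \<open>g = gcd (T + 1, X\<^sup>q - 1)\<close>. The identity \<open>X f' g = T + X\<^sup>q\<close> shows that \<open>f\<close> has no
  linear term, and then \<open>g\<close> has none either.
\<close>

hide_const (open) Polynomials.lead_coeff Polynomials.degree up_ring.coeff up_ring.monom module.smult


section \<open>Primes congruent to 1 modulo \<open>4 p\<close>\<close>

text \<open>The polynomial T and the modulus 4 p come from Gaussian periods. For q = 1 modulo 4, the
  values of T at the complex primitive q-th roots of unity are (-1 + sqrt q) / 2 and (-1 - sqrt q) /
  2, the roots of Y^2 + Y - (q - 1) / 4. If 4 p divides q - 1, the constant term of this quadratic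
  vanishes modulo p, and so does T(1) = (q - 1) / 2. The obstacle is not to factor X^q - 1 over F_p
  but to find two factors that both lack a linear term. The factorization is constructed in Z[X],
  with divisibility by the constant polynomial p in place of equality over F_p. One pair of integer
  polynomials then serves every field of characteristic p, however its elements are
  represented.\<close>

lemma four_mult_prime_dvd_minus_one:
  fixes p q y :: nat
  assumes p: "Factorial_Ring.prime p" "odd p" and q: "Factorial_Ring.prime q" "q \<noteq> 2" "q \<noteq> p"
    and K: "int q dvd (\<Sum>i<p. (- (int y)\<^sup>2) ^ i)"
  shows "4 * p dvd q - 1"
proof -
  \<comment> \<open>The sum in \<open>K\<close> is the 4p-th cyclotomic polynomial at y, which is
    the p-th one at -y^2. So y should have order exactly 4 p modulo q, and the proper divisors of 4
    p have to be excluded.\<close>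
  define z where "z = - (int y)\<^sup>2"
  have "z ^ p - 1 = (z - 1) * (\<Sum>i<p. z ^ i)"
    by (rule power_diff_1_eq)
  then have zp: "[z ^ p = 1] (mod int q)"
    using K by (simp add: z_def cong_iff_dvd_diff)
  have zp': "z ^ p = - (int y ^ (2 * p))"
    using \<open>odd p\<close> by (simp add: z_def power_mult)
  have neg: "[int y ^ (2 * p) = - 1] (mod int q)"
    using zp cong_minus_minus_iff[of "z ^ p" 1 "int q"] zp' by simp
  have two: "\<not> int q dvd 2"
  proof
    assume "int q dvd 2"
    then have "int q dvd int 2" by simp
    then have "q dvd 2" by (simp only: int_dvd_int_iff)
    then show False using q(1,2) primes_dvd_imp_eq[OF q(1) two_is_prime_nat] by blast
  qed
  have "[int y ^ (2 * p) * int y ^ (2 * p) = (- 1) * (- 1)] (mod int q)"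
    by (rule cong_mult[OF neg neg])
  then have "[int (y ^ (4 * p)) = int 1] (mod int q)"
    by (simp flip: power_add)
  then have "ord q y dvd 4 * p"
    using cong_int_iff ord_divides by blast
  have n2: "\<not> ord q y dvd 2 * p"
  proof
    assume "ord q y dvd 2 * p"
    then have "[int (y ^ (2 * p)) = int 1] (mod int q)"
      using cong_int_iff ord_divides by blast
    then have "[1 = - 1] (mod int q)"
      using neg by (simp add: cong_def)
    then show False using two by (simp add: cong_iff_dvd_diff)
  qed
  \<comment> \<open>If y^4 = 1, then z^2 = 1, and z = z^p = 1 because p is odd. The sum of p powers
    of z is then p, which q does not divide.\<close>
  have n4: "\<not> ord q y dvd 4"
  proof
    assume "ord q y dvd 4"
    then have "[int (y ^ 4) = int 1] (mod int q)"
      using cong_int_iff ord_divides by blast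
    then have z2: "[z\<^sup>2 = 1] (mod int q)"
      by (simp add: z_def flip: power_mult)
    obtain k where k: "p = 2 * k + 1" using \<open>odd p\<close> by (rule oddE)
    have "[(z\<^sup>2) ^ k * z = 1 ^ k * z] (mod int q)"
      by (intro cong_mult cong_pow z2 cong_refl)
    then have "[z ^ p = z] (mod int q)"
      by (simp add: k mult.commute flip: power_mult)
    then have z1: "[z = 1] (mod int q)" using zp by (simp add: cong_def)
    have "[(\<Sum>i<p. z ^ i) = (\<Sum>i<p. 1 ^ i)] (mod int q)"
      by (intro cong_sum cong_pow z1)
    then have "int q dvd int p"
      using K by (simp add: z_def cong_dvd_iff)
    then show False using p q by (simp add: primes_dvd_imp_eq)
  qed
  have "p dvd ord q y"
  proof (rule ccontr)
    assume "\<not> p dvd ord q y"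
    then have "coprime (ord q y) p" using p(1) by (simp add: prime_imp_coprime coprime_commute)
    then show False using \<open>ord q y dvd 4 * p\<close> n4 by (simp add: coprime_dvd_mult_left_iff)
  qed
  then obtain d where d: "ord q y = p * d" ..
  with \<open>ord q y dvd 4 * p\<close> n2 p have "d dvd 4" "\<not> d dvd 2" by (auto simp: prime_gt_0_nat mult.commute)
  then have "d = 4"
  proof -
    have "d \<le> 4" using \<open>d dvd 4\<close> by (rule dvd_imp_le) simp
    then consider "d = 0" | "d = 1" | "d = 2" | "d = 3" | "d = 4" by linarith
    then show ?thesis using \<open>d dvd 4\<close> \<open>\<not> d dvd 2\<close> by cases auto
  qed
  moreover have "coprime q y"
    using d p \<open>d = 4\<close> ord_eq_0[of q y] by (auto simp: prime_gt_0_nat)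
  ultimately show ?thesis
    using d order_divides_totient[of q y] q by (simp add: totient_prime mult.commute)
qed

text \<open>The case p = 2, where the eighth cyclotomic polynomial is y^4 + 1: the order of y
  divides 8 but not 4, because y^4 = -1.\<close>

lemma eight_dvd_minus_one:
  fixes q y :: nat
  assumes q: "Factorial_Ring.prime q" "q \<noteq> 2" and K: "q dvd y ^ 4 + 1"
  shows "8 dvd q - 1"
proof -
  have neg: "[int y ^ 4 = - 1] (mod int q)"
  proof -
    have "int q dvd int (y ^ 4 + 1)" using K by (simp only: int_dvd_int_iff)
    then show ?thesis by (simp add: cong_iff_dvd_diff add.commute)
  qed
  have two: "\<not> int q dvd 2"
  proof
    assume "int q dvd 2"
    then have "int q dvd int 2" by simp
    then have "q dvd 2" by (simp only: int_dvd_int_iff)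
    then show False using q(1,2) primes_dvd_imp_eq[OF q(1) two_is_prime_nat] by blast
  qed
  have "[int y ^ 4 * int y ^ 4 = (- 1) * (- 1)] (mod int q)"
    by (rule cong_mult[OF neg neg])
  then have "[int (y ^ 8) = int 1] (mod int q)"
    by (simp flip: power_add)
  then have "ord q y dvd 8"
    using cong_int_iff ord_divides by blast
  then have 8: "ord q y dvd 2 ^ 3" by simp
  have n4: "\<not> ord q y dvd 2 ^ 2"
  proof
    assume "ord q y dvd 2 ^ 2"
    then have "ord q y dvd 4" by simp
    then have "[int (y ^ 4) = int 1] (mod int q)"
      using cong_int_iff ord_divides by blast
    then have "[1 = - 1] (mod int q)"
      using neg by (simp add: cong_def)
    then show False using two by (simp add: cong_iff_dvd_diff)
  qed
  obtain i where i: "i \<le> 3" "ord q y = 2 ^ i"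
    using 8 divides_primepow_nat[OF two_is_prime_nat] by blast
  have "i = 3"
  proof (rule ccontr)
    assume "i \<noteq> 3"
    then have "i \<le> 2" using i(1) by simp
    then have "ord q y dvd 2 ^ 2" unfolding i(2) by (rule le_imp_power_dvd)
    with n4 show False ..
  qed
  moreover have "coprime q y"
    using i ord_eq_0[of q y] by auto
  ultimately show ?thesis
    using i order_divides_totient[of q y] q by (simp add: totient_prime)
qed

lemma infinite_primes_one_mod_four_mult:
  fixes p :: nat
  assumes p: "Factorial_Ring.prime p"
  shows "infinite {q. Factorial_Ring.prime q \<and> 4 * p dvd q - 1}"
  unfolding infinite_nat_iff_unbounded
proof
  fix N :: nat
  \<comment> \<open>The factorial pushes every prime not dividing y above N + 2, in particular away
    from 2; the factor p keeps it different from p.\<close>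
  define y where "y = p * fact (N + 2)"
  have y2: "y \<ge> 2"
    unfolding y_def using prime_ge_2_nat[OF p] fact_ge_1[of "N + 2", where 'a = nat]
      mult_le_mono[of 2 p 1 "fact (N + 2)"] by simp
  have big: "q > N \<and> q \<noteq> 2 \<and> q \<noteq> p" if q: "Factorial_Ring.prime q" "\<not> q dvd y" for q
  proof -
    have "\<not> q \<le> N + 2"
    proof
      assume "q \<le> N + 2"
      then have "q dvd fact (N + 2)" using prime_ge_1_nat[OF q(1)] by (rule dvd_fact[rotated])
      then show False using q(2) by (simp add: y_def)
    qed
    moreover have "q \<noteq> p" using q by (auto simp: y_def)
    ultimately show ?thesis by auto
  qed
  show "\<exists>q>N. q \<in> {q. Factorial_Ring.prime q \<and> 4 * p dvd q - 1}"
  proof (cases "p = 2")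
    case True
    have "y ^ 4 + 1 \<noteq> 1" using y2 by simp
    then obtain q where q: "Factorial_Ring.prime q" "q dvd y ^ 4 + 1" by (rule prime_factor_nat[THEN exE]) auto
    have "\<not> q dvd y"
    proof
      assume "q dvd y"
      then have "q dvd y ^ 4" by (simp add: power4_eq_xxxx)
      then have "q dvd 1" using q(2) dvd_add_right_iff by blast
      then show False using q(1) by simp
    qed
    with big q(1) have "q > N" "q \<noteq> 2" by auto
    moreover have "4 * p dvd q - 1"
      using eight_dvd_minus_one[OF q(1) \<open>q \<noteq> 2\<close> q(2)] True by simp
    ultimately show ?thesis using q(1) by auto
  next
    case False
    then have "odd p" using p by (metis prime_odd_nat prime_ge_2_nat le_neq_implies_less)
    define z where "z = - (int y)\<^sup>2"
    define K where "K = (\<Sum>i<p. z ^ i)"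
    \<comment> \<open>Since (z - 1) K = z^p - 1, the value 1 would force y^(2 p) = y^2, impossible
      for y \<ge> 2. Hence K has a prime divisor.\<close>
    have "\<bar>K\<bar> \<noteq> 1"
    proof
      assume "\<bar>K\<bar> = 1"
      have "z ^ p - 1 = (z - 1) * K" unfolding K_def by (rule power_diff_1_eq)
      then have "\<bar>z ^ p - 1\<bar> = \<bar>z - 1\<bar>" using \<open>\<bar>K\<bar> = 1\<close> by (simp add: abs_mult)
      moreover have "z ^ p = - (int y ^ (2 * p))"
        using \<open>odd p\<close> by (simp add: z_def power_mult)
      ultimately have "int y ^ (2 * p) + 1 = int y ^ 2 + 1"
        by (smt (verit) z_def zero_le_power of_nat_0_le_iff)
      then have "int y ^ (2 * p) = int y ^ 2" by simp
      moreover have "int y ^ 2 < int y ^ (2 * p)"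
        using y2 prime_ge_2_nat[OF p] by (intro power_strict_increasing) auto
      ultimately show False by simp
    qed
    then have "nat \<bar>K\<bar> \<noteq> 1" by simp
    then obtain q where q: "Factorial_Ring.prime q" "q dvd nat \<bar>K\<bar>" by (rule prime_factor_nat[THEN exE]) auto
    then have qK: "int q dvd K" by simp
    \<comment> \<open>K is 1 modulo z, so none of its prime divisors divides y.\<close>
    have K1: "K = 1 + z * (\<Sum>i<p-1. z ^ i)"
    proof -
      obtain m where "p = Suc m" using prime_gt_0_nat[OF p] gr0_implies_Suc by blast
      then show ?thesis by (simp add: K_def sum.lessThan_Suc_shift sum_distrib_left del: sum.lessThan_Suc)
    qed
    have "\<not> q dvd y"
    proof
      assume "q dvd y"
      then have "int q dvd z" by (simp add: z_def power2_eq_square)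
      then have "int q dvd 1"
        using qK K1 by (metis dvd_add_left_iff dvd_mult2)
      then show False using q(1) by simp
    qed
    with big q(1) have b: "q > N" "q \<noteq> 2" "q \<noteq> p" by auto
    have "4 * p dvd q - 1"
      using four_mult_prime_dvd_minus_one[OF p \<open>odd p\<close> q(1) b(2,3)] qK by (simp add: K_def z_def)
    then show ?thesis using q(1) b(1) by auto
  qed
qed


section \<open>Quadratic nonresidues\<close>

lemma Legendre_cong:
  assumes "[a = b] (mod q)"
  shows "Legendre a q = Legendre b q"
proof -
  have "[a = 0] (mod q) \<longleftrightarrow> [b = 0] (mod q)" "\<And>y. [y\<^sup>2 = a] (mod q) \<longleftrightarrow> [y\<^sup>2 = b] (mod q)"
    using assms by (auto simp: cong_def)
  then show ?thesis by (simp add: Legendre_def QuadRes_def)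
qed

lemma Legendre_values: "Legendre a q \<in> {-1, 0, 1}"
  by (simp add: Legendre_def)

lemma Legendre_eq_0_iff: "Legendre a q = 0 \<longleftrightarrow> q dvd a"
  by (simp add: Legendre_def cong_0_iff)

text \<open>Distinct numbers among -1, 0, 1 differ by at most 2, which is less than q. This turns
  the congruences of Euler's criterion into equalities of Legendre symbols.\<close>

lemma eq_if_cong_of_small:
  fixes a b q :: int
  assumes "[a = b] (mod q)" "a \<in> {-1, 0, 1}" "b \<in> {-1, 0, 1}" "2 < q"
  shows "a = b"
proof (rule ccontr)
  assume "a \<noteq> b"
  moreover have "q dvd a - b" using assms(1) by (simp add: cong_iff_dvd_diff)
  ultimately have "\<bar>q\<bar> \<le> \<bar>a - b\<bar>" by (intro dvd_imp_le_int) auto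
  then show False using assms by auto
qed

lemma Legendre_mult:
  assumes "Factorial_Ring.prime q" "2 < q"
  shows "Legendre (a * b) (int q) = Legendre a (int q) * Legendre b (int q)"
proof (rule eq_if_cong_of_small)
  show "[Legendre (a * b) (int q) = Legendre a (int q) * Legendre b (int q)] (mod int q)"
  proof -
    have "[Legendre a (int q) * Legendre b (int q)
        = a ^ ((q - 1) div 2) * b ^ ((q - 1) div 2)] (mod int q)"
      by (intro cong_mult euler_criterion assms)
    also have "a ^ ((q - 1) div 2) * b ^ ((q - 1) div 2) = (a * b) ^ ((q - 1) div 2)"
      by (simp add: power_mult_distrib)
    finally show ?thesis
      using euler_criterion[OF assms, of "a * b"] by (simp add: cong_def)
  qed
qed (use assms Legendre_values[of a "int q"] Legendre_values[of b "int q"]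
    Legendre_values[of "a * b" "int q"] in auto)

lemma Legendre_one: "1 < q \<Longrightarrow> Legendre 1 q = 1"
  by (auto simp: Legendre_def QuadRes_def cong_def zmod_eq_0_iff intro: exI[of _ 1])

lemma Legendre_minus_one:
  assumes "Factorial_Ring.prime q" "2 < q" "4 dvd q - 1"
  shows "Legendre (- 1) (int q) = 1"
proof (rule eq_if_cong_of_small)
  have "even ((q - 1) div 2)" using assms(3) by (auto elim!: dvdE)
  then show "[Legendre (- 1) (int q) = 1] (mod int q)"
    using euler_criterion[OF assms(1,2), of "- 1"] by simp
qed (use assms Legendre_values[of "- 1" "int q"] in auto)

text \<open>A primitive root works: its order q - 1 does not divide (q - 1) / 2, so Euler's
  criterion excludes the value 1.\<close>

lemma Legendre_nonresidue_exists:
  assumes "Factorial_Ring.prime q" "2 < q"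
  obtains u where "Legendre u (int q) = - 1" "\<not> int q dvd u"
proof -
  obtain g where g: "residue_primroot q g"
    using prime_primitive_root_exists assms by (metis prime_gt_1_nat)
  then have o: "ord q g = q - 1" "coprime q g"
    using assms by (simp_all add: residue_primroot_def totient_prime)
  have "\<not> int q dvd int g"
    using o(2) assms prime_gt_1_nat[of q] coprime_absorb_left[of q g] by auto
  moreover have "Legendre (int g) (int q) \<noteq> 1"
  proof
    assume "Legendre (int g) (int q) = 1"
    then have "[int 1 = int (g ^ ((q - 1) div 2))] (mod int q)"
      using euler_criterion[OF assms, of "int g"] by simp
    then have "[g ^ ((q - 1) div 2) = 1] (mod q)"
      by (simp only: cong_int_iff cong_sym_eq)
    then have "q - 1 dvd (q - 1) div 2" using o ord_divides by metis
    then have "q - 1 \<le> (q - 1) div 2" using assms(2) by (intro dvd_imp_le) auto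
    then show False using assms(2) by simp
  qed
  ultimately show thesis
    using that[of "int g"] Legendre_values[of "int g" "int q"] Legendre_eq_0_iff[of "int g" "int q"] by auto
qed

section \<open>Sums over a complete system of residues\<close>

lemma bij_betw_affine_mod:
  fixes u v q :: int
  assumes "coprime u q" "0 < q"
  shows "bij_betw (\<lambda>a. (u * a + v) mod q) {0..<q} {0..<q}"
proof (rule bij_betwI')
  show "(u * x + v) mod q = (u * y + v) mod q \<longleftrightarrow> x = y" if "x \<in> {0..<q}" "y \<in> {0..<q}" for x y
  proof
    assume "(u * x + v) mod q = (u * y + v) mod q"
    then have "[u * x + v = u * y + v] (mod q)" by (simp add: cong_def)
    then have "[x = y] (mod q)"
      using assms(1) by (simp add: cong_add_rcancel cong_mult_lcancel)
    then show "x = y" using that by (simp add: cong_def)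
  qed simp
  show "(u * x + v) mod q \<in> {0..<q}" for x using assms(2) by simp
  show "\<exists>x\<in>{0..<q}. y = (u * x + v) mod q" if "y \<in> {0..<q}" for y
  proof -
    obtain w where w: "[u * w = 1] (mod q)" using assms(1) cong_solve_coprime_int by blast
    have "[u * ((w * (y - v)) mod q) + v = u * w * (y - v) + v] (mod q)"
      by (simp add: cong_def mult.assoc) (metis mod_add_left_eq mod_mult_right_eq)
    also have "[u * w * (y - v) + v = 1 * (y - v) + v] (mod q)"
      by (intro cong_add cong_mult w) auto
    finally have "(u * ((w * (y - v)) mod q) + v) mod q = y"
      using that by (simp add: cong_def)
    then show ?thesis using assms(2) by (intro bexI[of _ "(w * (y - v)) mod q"]) auto
  qed
qed

lemma sum_affine_mod:
  fixes u v q :: int and h :: "int \<Rightarrow> int"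
  assumes "coprime u q" "0 < q" "\<And>a. h (a mod q) = h a"
  shows "(\<Sum>a\<in>{0..<q}. h (u * a + v)) = (\<Sum>a\<in>{0..<q}. h a)"
  using sum.reindex_bij_betw[OF bij_betw_affine_mod[OF assms(1,2), of v], of h] by (simp add: assms(3))

text \<open>Scaling by a nonresidue permutes the residues and changes the sign of every summand, so
  the sum equals its own negative.\<close>

lemma sum_Legendre:
  assumes "Factorial_Ring.prime q" "2 < q"
  shows "(\<Sum>a\<in>{0..<int q}. Legendre a (int q)) = 0"
proof -
  obtain u where u: "Legendre u (int q) = - 1" "\<not> int q dvd u"
    using Legendre_nonresidue_exists[OF assms] .
  have "coprime u (int q)"
    using u(2) assms(1) prime_imp_coprime[of "int q" u] by (simp add: coprime_commute)
  then have "(\<Sum>a\<in>{0..<int q}. Legendre (u * a + 0) (int q)) = (\<Sum>a\<in>{0..<int q}. Legendre a (int q))"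
    by (rule sum_affine_mod) (use assms in \<open>auto intro!: Legendre_cong\<close>)
  then show ?thesis
    by (simp add: Legendre_mult[OF assms] u(1) sum_negf)
qed

text \<open>For \<open>a \<noteq> 0\<close> the substitution \<open>t = c / a - 1\<close> turns the summand into \<open>\<chi>(t)\<close>, and
  \<open>t\<close> runs through all residues except \<open>- 1\<close>.\<close>

lemma Jacobsthal_sum:
  assumes q: "Factorial_Ring.prime q" "2 < q" and c: "\<not> int q dvd c"
  shows "(\<Sum>a\<in>{0..<int q}. Legendre a (int q) * Legendre (c - a) (int q)) = - Legendre (- 1) (int q)"
proof -
  let ?q = "int q"
  define w where "w a = (SOME b. [a * b = 1] (mod ?q))" for a
  define t where "t a = (c * w a - 1) mod ?q" for a
  have w: "[a * w a = 1] (mod ?q)" if "a \<in> {0<..<?q}" for a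
  proof -
    have "\<not> ?q dvd a" using that zdvd_not_zless by auto
    then have "coprime a ?q" using q prime_imp_coprime[of ?q a] by (simp add: coprime_commute)
    then show ?thesis unfolding w_def by (rule someI_ex[OF cong_solve_coprime_int])
  qed
  have at: "[a * t a = c - a] (mod ?q)" if "a \<in> {0<..<?q}" for a
  proof -
    have "[a * t a = c * (a * w a) - a] (mod ?q)"
      unfolding t_def by (simp add: cong_def mod_simps algebra_simps)
    also have "[c * (a * w a) - a = c * 1 - a] (mod ?q)"
      by (intro cong_diff cong_mult w that) auto
    finally show ?thesis by simp
  qed
  have summand: "Legendre a ?q * Legendre (c - a) ?q = Legendre (t a) ?q" if "a \<in> {0<..<?q}" for a
  proof -
    have "\<not> ?q dvd a" using that zdvd_not_zless by auto
    then have "Legendre a ?q * Legendre a ?q = 1"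
      using Legendre_values[of a ?q] Legendre_eq_0_iff[of a ?q] by auto
    then show ?thesis
      using Legendre_cong[OF at[OF that]] Legendre_mult[OF q, of a "t a"]
      by (metis mult.assoc mult_1)
  qed
  have bij: "bij_betw t {0<..<?q} {0..<?q - 1}"
    unfolding bij_betw_def
  proof
    show inj: "inj_on t {0<..<?q}"
    proof (rule inj_onI)
      fix a b assume ab: "a \<in> {0<..<?q}" "b \<in> {0<..<?q}" "t a = t b"
      have "[c = a * t a + a] (mod ?q)"
        using cong_add[OF at[OF ab(1)] cong_refl[of a]] by (simp add: cong_sym_eq)
      moreover have "[c = b * t a + b] (mod ?q)"
        using cong_add[OF at[OF ab(2)] cong_refl[of b]] ab(3) by (simp add: cong_sym_eq)
      ultimately have "[a * (t a + 1) = b * (t a + 1)] (mod ?q)"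
        by (simp add: cong_def algebra_simps)
      \<comment> \<open>Modulo q, \<open>t a + 1\<close> is c / a; being invertible, it determines
        a.\<close>
      moreover have "\<not> ?q dvd t a + 1"
      proof
        assume "?q dvd t a + 1"
        then have "?q dvd a * t a + a" by (metis distrib_left dvd_mult mult.right_neutral)
        then show False using c \<open>[c = a * t a + a] (mod ?q)\<close> cong_dvd_iff by blast
      qed
      then have "coprime (t a + 1) ?q" using q prime_imp_coprime[of ?q "t a + 1"] by (simp add: coprime_commute)
      ultimately have "[a = b] (mod ?q)" by (simp add: cong_mult_rcancel)
      then show "a = b" using ab by (simp add: cong_def)
    qed
    have "t ` {0<..<?q} \<subseteq> {0..<?q - 1}"
    proof
      fix s assume "s \<in> t ` {0<..<?q}"
      then obtain a where a: "a \<in> {0<..<?q}" "s = t a" by blast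
      have "0 \<le> s" "s < ?q" using q by (auto simp: a t_def)
      moreover have "s \<noteq> ?q - 1"
      proof
        assume "s = ?q - 1"
        then have "[a * (?q - 1) = c - a] (mod ?q)" using at[OF a(1)] a(2) by metis
        then have "[c = a * (?q - 1) + a] (mod ?q)"
          using cong_add[of "a * (?q - 1)" "c - a" ?q a a] by (simp add: cong_sym_eq)
        then show False using c by (simp add: cong_dvd_iff algebra_simps)
      qed
      ultimately show "s \<in> {0..<?q - 1}" by simp
    qed
    then show "t ` {0<..<?q} = {0..<?q - 1}"
      by (intro card_subset_eq) (auto simp: card_image[OF inj])
  qed
  have "{0..<?q} = insert 0 {0<..<?q}" using q by auto
  then have "(\<Sum>a\<in>{0..<?q}. Legendre a ?q * Legendre (c - a) ?q)
      = (\<Sum>a\<in>{0<..<?q}. Legendre a ?q * Legendre (c - a) ?q)"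
    by (simp add: Legendre_eq_0_iff)
  also have "\<dots> = (\<Sum>a\<in>{0<..<?q}. Legendre (t a) ?q)"
    by (intro sum.cong refl summand)
  also have "\<dots> = (\<Sum>s\<in>{0..<?q - 1}. Legendre s ?q)"
    by (rule sum.reindex_bij_betw[OF bij])
  also have "\<dots> = (\<Sum>s\<in>{0..<?q}. Legendre s ?q) - Legendre (?q - 1) ?q"
  proof -
    have "{0..<?q} = insert (?q - 1) {0..<?q - 1}" using q by auto
    then show ?thesis by simp
  qed
  also have "Legendre (?q - 1) ?q = Legendre (- 1) ?q"
    by (rule Legendre_cong) (simp add: cong_iff_dvd_diff)
  finally show ?thesis by (simp add: sum_Legendre[OF q])
qed

text \<open>The choice of the nonresidues matters. With the residues, X - 1 would pass from one
  factor of X^q - 1 to the other, and both factors would acquire a linear term.\<close>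

definition nonresidue :: "int \<Rightarrow> int \<Rightarrow> int" where
  "nonresidue q a = (if Legendre a q = - 1 then 1 else 0)"

lemma nonresidue_mod [simp]: "nonresidue q (a mod q) = nonresidue q a"
  using Legendre_cong[of "a mod q" a q] by (simp add: nonresidue_def)

text \<open>The indicator is half of a combination of 1, the point mass at 0 and the quadratic
  character; doubling keeps the computation in the integers and explains the 4 in the convolution
  formula.\<close>

lemma double_nonresidue:
  "2 * nonresidue q a = 1 - of_bool (q dvd a) - Legendre a q"
  using Legendre_values[of a q] Legendre_eq_0_iff[of a q] by (auto simp: nonresidue_def)

text \<open>Expanding by \<open>double_nonresidue\<close> leaves point masses at 0 and the
  correlation sum of \<chi>. If q does not divide c, four times the convolution is q - 3 + 2
  \<chi>(c), because \<chi>(-1) = 1. Adding 4 \<open>nonresidue (int q) c\<close>, which is 2 - 2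
  \<chi>(c), cancels the dependence on \<chi>(c): hence T^2 + T rather than T^2.\<close>

lemma nonresidue_convolution:
  assumes q: "Factorial_Ring.prime q" "2 < q" "4 dvd q - 1"
  shows "4 * ((\<Sum>a\<in>{0..<int q}. nonresidue (int q) a * nonresidue (int q) (c - a)) + nonresidue (int q) c)
     = (if int q dvd c then 2 * (int q - 1) else int q - 1)"
proof -
  let ?q = "int q"
  let ?d = "\<lambda>a. of_bool (?q dvd a) :: int" and ?L = "\<lambda>a. Legendre a ?q" and ?Z = "{0..<?q}"
  have neg: "?L (- 1) = 1" by (rule Legendre_minus_one[OF q])
  have q0: "0 < ?q" using q by simp
  have refl: "(\<Sum>a\<in>?Z. h (c - a)) = (\<Sum>a\<in>?Z. h a)" if "\<And>a. h (a mod ?q) = h a" for h :: "int \<Rightarrow> int"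
    using sum_affine_mod[of "- 1" ?q h c] q0 that by simp
  have pm: "?d (a mod ?q) = ?d a" "?L (a mod ?q) = ?L a" for a
    by (simp_all add: dvd_mod_iff Legendre_cong)
  have sd: "(\<Sum>a\<in>?Z. ?d a * h a) = h 0" for h :: "int \<Rightarrow> int"
  proof -
    have "?Z = insert 0 {0<..<?q}" using q0 by auto
    moreover have "(\<Sum>a\<in>{0<..<?q}. ?d a * h a) = 0"
      by (rule sum.neutral) (use zdvd_not_zless in auto)
    ultimately show ?thesis by simp
  qed
  have sd': "(\<Sum>a\<in>?Z. ?d (c - a) * ?L a) = ?L c"
  proof -
    \<comment> \<open>Writing a as c - (c - a) makes the summand a function of c - a, so that the
      reflection \<open>refl\<close> applies.\<close>
    have "(\<Sum>a\<in>?Z. ?d (c - a) * ?L a) = (\<Sum>a\<in>?Z. ?d (c - a) * ?L (c - (c - a)))" by simp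
    also have "\<dots> = (\<Sum>a\<in>?Z. ?d a * ?L (c - a))"
    proof (rule refl)
      fix a
      have "?L (c - a mod ?q) = ?L (c - a)"
        by (rule Legendre_cong) (simp add: cong_def mod_diff_right_eq)
      then show "?d (a mod ?q) * ?L (c - a mod ?q) = ?d a * ?L (c - a)"
        by (simp only: pm)
    qed
    finally show ?thesis by (simp only: sd diff_0_right)
  qed
  have "4 * (\<Sum>a\<in>?Z. nonresidue ?q a * nonresidue ?q (c - a))
     = (\<Sum>a\<in>?Z. (2 * nonresidue ?q a) * (2 * nonresidue ?q (c - a)))"
    by (simp add: sum_distrib_left mult_ac)
  \<comment> \<open>The factor \<open>* 1\<close> makes the term an instance of \<open>sd\<close>
    for a constant function.\<close>
  also have "\<dots> = (\<Sum>a\<in>?Z. (1 - ?d a * 1) - ?L a - ?d (c - a) - ?L (c - a)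
      + ?d a * ?d (c - a) + ?d a * ?L (c - a) + ?d (c - a) * ?L a + ?L a * ?L (c - a))"
  proof -
    have "(1 - d - l) * (1 - d' - l') = (1 - d * 1) - l - d' - l' + d * d' + d * l' + d' * l + l * l'"
      for d d' l l' :: int by (simp add: algebra_simps)
    then show ?thesis by (simp only: double_nonresidue)
  qed
  also have "\<dots> = (?q - 1) - 0 - 1 - 0 + ?d c + ?L c + ?L c + (\<Sum>a\<in>?Z. ?L a * ?L (c - a))"
  proof -
    have sd1: "(\<Sum>a\<in>?Z. ?d a) = 1" using sd[of "\<lambda>_. 1"] by (simp only: mult_1_right)
    have sL: "(\<Sum>a\<in>?Z. ?L a) = 0" by (rule sum_Legendre[OF q(1,2)])
    have s1: "(\<Sum>a\<in>?Z. 1) = ?q" by simp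
    show ?thesis
      by (simp only: sum.distrib sum_subtractf sd sd' refl[of ?d, OF pm(1)] refl[of ?L, OF pm(2)]
          sd1 sL s1 mult_1_right diff_0_right)
  qed
  finally have *: "4 * (\<Sum>a\<in>?Z. nonresidue ?q a * nonresidue ?q (c - a))
     = ?q - 2 + ?d c + 2 * ?L c + (\<Sum>a\<in>?Z. ?L a * ?L (c - a))" by simp
  show ?thesis
  proof (cases "?q dvd c")
    case False
    then show ?thesis
      using * Jacobsthal_sum[OF q(1,2) False] double_nonresidue[of ?q c] neg by simp
  next
    case True
    have "?L a * ?L (c - a) = 1 - ?d a * 1" for a
    proof -
      have "?L (c - a) = ?L ((- 1) * a)"
        using True by (intro Legendre_cong) (simp add: cong_iff_dvd_diff)
      then have "?L (c - a) = ?L a"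
        using Legendre_mult[OF q(1,2), of "- 1" a] neg by simp
      then show ?thesis using Legendre_values[of a ?q] Legendre_eq_0_iff[of a ?q] by auto
    qed
    then have "(\<Sum>a\<in>?Z. ?L a * ?L (c - a)) = ?q - 1"
      by (simp only: sum_subtractf sd) simp
    moreover have "?L c = 0" using True by (simp add: Legendre_eq_0_iff)
    ultimately show ?thesis
      using * True by (simp add: nonresidue_def)
  qed
qed


section \<open>A factor of \<open>X\<^sup>q - 1\<close> modulo \<open>p\<close>\<close>

text \<open>Pseudo-division multiplies the dividend by a power of the leading coefficient of the
  divisor, and here that power is 1.\<close>

lemma monic_division:
  fixes m h :: "'a :: idom poly"
  assumes m: "lead_coeff m = 1"
  obtains a r where "h = m * a + r" "r = 0 \<or> degree r < degree m"
proof -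
  obtain a r where ar: "pseudo_divmod h m = (a, r)" by fastforce
  have "m \<noteq> 0" using m by auto
  from pseudo_divmod[OF this ar] m show thesis by (intro that[of a r]) simp_all
qed

text \<open>Here f lifts the monic generator of the image of I in F_p[X]; it is a monic element of I
  of least degree. An element of smaller degree whose leading coefficient is invertible modulo p
  could be made monic, against minimality. Otherwise its leading term is a multiple of p, lies in I
  and can be removed.\<close>

lemma monic_generator_mod_prime:
  fixes I :: "int poly set" and p :: int
  assumes p: "Factorial_Ring.prime p"
    and add: "\<And>a b. a \<in> I \<Longrightarrow> b \<in> I \<Longrightarrow> a + b \<in> I"
    and mult: "\<And>r a. a \<in> I \<Longrightarrow> r * a \<in> I"
    and pI: "[:p:] \<in> I" and m: "m \<in> I" "lead_coeff m = 1"
  obtains f where "f \<in> I" "lead_coeff f = 1" "degree f \<le> degree m"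
    "\<And>h. h \<in> I \<Longrightarrow> degree h < degree f \<Longrightarrow> [:p:] dvd h"
proof -
  define f where "f = arg_min degree (\<lambda>h. h \<in> I \<and> lead_coeff h = 1)"
  have f: "f \<in> I" "lead_coeff f = 1"
    and min: "\<And>h. h \<in> I \<Longrightarrow> lead_coeff h = 1 \<Longrightarrow> degree f \<le> degree h"
    using arg_min_nat_lemma[of "\<lambda>h. h \<in> I \<and> lead_coeff h = 1" m degree] m
    unfolding f_def by auto
  have small: "[:p:] dvd h" if "h \<in> I" "degree h < degree f" for h
    using that
  proof (induction "degree h" arbitrary: h rule: less_induct)
    case less
    show ?case
    proof (cases "h = 0")
      case False
      define c where "c = lead_coeff h"
      have "p dvd c"
      proof (rule ccontr)
        assume "\<not> p dvd c"
        then have "coprime c p" using p prime_imp_coprime[of p c] by (simp add: coprime_commute)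
        then obtain u where "[c * u = 1] (mod p)" using cong_solve_coprime_int by blast
        then obtain v where v: "u * c + v * p = 1"
          by (metis cong_iff_lin mult.commute cong_sym)
        \<comment> \<open>The leading coefficient is u c + v p = 1, so this is a monic element of I
          of smaller degree than f.\<close>
        define h' where "h' = [:u:] * h + monom v (degree h) * [:p:]"
        have "h' \<in> I" unfolding h'_def by (intro add mult less.prems pI)
        have h': "h' = smult u h + monom (v * p) (degree h)"
          by (simp add: h'_def smult_monom mult.commute)
        have "coeff h' (degree h) = 1" by (simp add: h' v flip: c_def)
        moreover have "degree h' \<le> degree h"
          unfolding h' by (intro degree_add_le degree_smult_le degree_monom_le)
        ultimately have "degree h' = degree h" by (simp add: le_antisym le_degree)
        then show False
          using min[OF \<open>h' \<in> I\<close>] \<open>coeff h' (degree h) = 1\<close> less.prems(2) by simp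
      qed
      then obtain e where e: "c = p * e" ..
      define h' where "h' = h - monom c (degree h)"
      have "h' = h + monom (- e) (degree h) * [:p:]"
        by (simp add: h'_def e smult_monom mult.commute flip: minus_monom)
      also have "\<dots> \<in> I" by (intro add mult less.prems pI)
      finally have "h' \<in> I" .
      have dvd: "[:p:] dvd monom c (degree h)"
        using \<open>p dvd c\<close> by (simp add: const_poly_dvd_iff)
      have "[:p:] dvd h'"
      proof (cases "degree h = 0")
        case True
        then show ?thesis by (simp add: h'_def c_def const_poly_dvd_iff coeff_eq_0)
      next
        case pos: False
        have "degree h' \<le> degree h" unfolding h'_def by (intro degree_diff_le degree_monom_le order_refl)
        moreover have "coeff h' (degree h) = 0" by (simp add: h'_def c_def)
        ultimately have "degree h' < degree h"
          using pos by (metis eq_zero_or_degree_less degree_0 gr0I)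
        then show ?thesis using less.hyps \<open>h' \<in> I\<close> less.prems(2) by simp
      qed
      then have "[:p:] dvd h' + monom c (degree h)" using dvd by (rule dvd_add)
      then show ?thesis by (simp add: h'_def)
    qed simp
  qed
  show thesis using that[OF f min[OF m] small] .
qed

section \<open>The nonresidue polynomial modulo X^q - 1\<close>

definition nonresidue_poly :: "nat \<Rightarrow> int poly" where
  "nonresidue_poly q = (\<Sum>a<q. monom (nonresidue (int q) (int a)) a)"

lemma coeff_nonresidue_poly:
  "coeff (nonresidue_poly q) n = (if n < q then nonresidue (int q) (int n) else 0)"
  by (simp add: nonresidue_poly_def coeff_sum sum.delta')

lemma X_power_minus_one_dvd_monom_diff:
  "monom 1 q - 1 dvd (monom c n - monom c (n mod q) :: 'a :: comm_ring_1 poly)"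
proof -
  have "monom 1 q - 1 dvd (monom 1 q ^ (n div q) - 1 ^ (n div q) :: 'a poly)"
    unfolding power_diff_sumr2 by (rule dvd_triv_left)
  then have "monom 1 q - 1 dvd monom c (n mod q) * (monom 1 (q * (n div q)) - 1)"
    by (simp add: monom_power)
  also have "monom c (n mod q) * (monom 1 (q * (n div q)) - 1) = monom c n - monom c (n mod q)"
    by (simp add: algebra_simps mult_monom)
  finally show ?thesis .
qed

text \<open>Folding exponents modulo q turns T^2 into a polynomial whose coefficients are the
  convolution of \<open>nonresidue\<close> with itself. Those of T^2 + T then become (q - 1) / 4, or
  (q - 1) / 2 at exponent 0, and both are multiples of p.\<close>

lemma nonresidue_poly_square:
  assumes q: "Factorial_Ring.prime q" "2 < q" "4 * p dvd q - 1"
  shows "\<exists>w. [:int p:] dvd (nonresidue_poly q * (nonresidue_poly q + 1) - (monom 1 q - 1) * w)"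
proof -
  let ?T = "nonresidue_poly q" and ?M = "monom 1 q - 1 :: int poly"
  define t where "t a = nonresidue (int q) (int a)" for a
  have t_mod: "t (n mod q) = t n" for n
    by (metis t_def nonresidue_mod zmod_int)
  define N where "N c = (\<Sum>a<q. t a * nonresidue (int q) (int c - int a))" for c
  have "q > 0" using q by simp
  have bij: "bij_betw (\<lambda>b. (a + b) mod q) {..<q} {..<q}" for a
  proof (rule bij_betwI')
    show "(a + x) mod q = (a + y) mod q \<longleftrightarrow> x = y" if "x \<in> {..<q}" "y \<in> {..<q}" for x y
      using that cong_add_lcancel_nat[of a x y q] by (auto simp: cong_def)
    show "(a + x) mod q \<in> {..<q}" for x using \<open>q > 0\<close> by simp
    show "\<exists>x\<in>{..<q}. y = (a + x) mod q" if "y \<in> {..<q}" for y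
    proof
      have "(a + (y + (q - a mod q)) mod q) mod q = (a mod q + (y + (q - a mod q))) mod q"
        by (simp add: mod_simps)
      also have "a mod q + (y + (q - a mod q)) = y + q"
        using mod_less_divisor[OF \<open>q > 0\<close>, of a] by linarith
      finally show "y = (a + (y + (q - a mod q)) mod q) mod q" using that by simp
    qed (use \<open>q > 0\<close> in auto)
  qed
  have "?T * ?T = (\<Sum>a<q. \<Sum>b<q. monom (t a * t b) (a + b))"
    by (simp add: nonresidue_poly_def sum_product mult_monom t_def)
  also have "\<dots> = (\<Sum>a<q. \<Sum>b<q. monom (t a * t b) ((a + b) mod q))
      + (\<Sum>a<q. \<Sum>b<q. monom (t a * t b) (a + b) - monom (t a * t b) ((a + b) mod q))"
    by (simp add: sum_subtractf)
  also have "(\<Sum>a<q. \<Sum>b<q. monom (t a * t b) ((a + b) mod q)) = (\<Sum>a<q. \<Sum>c<q.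
      monom (t a * nonresidue (int q) (int c - int a)) c)"
  proof (rule sum.cong[OF refl])
    fix a
    have "t b = nonresidue (int q) (int ((a + b) mod q) - int a)" for b
      by (metis t_def nonresidue_mod zmod_int of_nat_add mod_diff_left_eq add_diff_cancel_left')
    then have "(\<Sum>b<q. monom (t a * t b) ((a + b) mod q))
        = (\<Sum>b<q. monom (t a * nonresidue (int q) (int ((a + b) mod q) - int a)) ((a + b) mod q))"
      by simp
    also have "\<dots> = (\<Sum>c<q. monom (t a * nonresidue (int q) (int c - int a)) c)"
      by (rule sum.reindex_bij_betw[OF bij])
    finally show "(\<Sum>b<q. monom (t a * t b) ((a + b) mod q))
        = (\<Sum>c<q. monom (t a * nonresidue (int q) (int c - int a)) c)" .
  qed
  also have "\<dots> = (\<Sum>c<q. monom (N c) c)"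
    by (subst sum.swap) (simp add: N_def monom_sum)
  finally have TT: "?T * ?T = (\<Sum>c<q. monom (N c) c)
      + (\<Sum>a<q. \<Sum>b<q. monom (t a * t b) (a + b) - monom (t a * t b) ((a + b) mod q))" .
  have "?M dvd (\<Sum>a<q. \<Sum>b<q. monom (t a * t b) (a + b) - monom (t a * t b) ((a + b) mod q))"
    by (intro dvd_sum X_power_minus_one_dvd_monom_diff)
  then obtain w where w: "(\<Sum>a<q. \<Sum>b<q. monom (t a * t b) (a + b) - monom (t a * t b) ((a + b) mod q)) = ?M * w" ..
  have "?T * (?T + 1) - ?M * w = (\<Sum>c<q. monom (N c + t c) c)"
    using TT w by (simp add: algebra_simps nonresidue_poly_def t_def sum.distrib flip: add_monom)
  moreover have "int p dvd N c + t c" for c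
  proof -
    have "N c = (\<Sum>a\<in>{0..<int q}. nonresidue (int q) a * nonresidue (int q) (int c - a))"
      unfolding N_def t_def by (rule sum.reindex_bij_witness[of _ nat int]) auto
    moreover have "4 dvd q - 1" using q(3) by (rule dvd_mult_left)
    ultimately have "4 * (N c + t c) = (if int q dvd int c then 2 * (int q - 1) else int q - 1)"
      using nonresidue_convolution[of q "int c"] q(1,2) unfolding t_def by argo
    moreover obtain k where "q - 1 = 4 * p * k" using q(3) ..
    then have "int q - 1 = 4 * (int p * int k)"
      using \<open>q > 0\<close> by (metis of_nat_diff of_nat_1 of_nat_mult of_nat_numeral Suc_leI One_nat_def mult.assoc)
    ultimately have "N c + t c = (if int q dvd int c then 2 * (int p * int k) else int p * int k)"
      by (simp split: if_splits)
    then show ?thesis by simp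
  qed
  ultimately have "[:int p:] dvd (?T * (?T + 1) - ?M * w)"
    by (auto simp: const_poly_dvd_iff coeff_sum intro!: dvd_sum)
  then show ?thesis ..
qed

lemma coeff_X_power_minus_one_mult:
  fixes k :: "int poly"
  assumes "q > 0"
  shows "coeff ((monom 1 q - 1) * k) (n + q) = coeff k n - coeff k (n + q)"
    and "n < q \<Longrightarrow> coeff ((monom 1 q - 1) * k) n = - coeff k n"
  by (simp_all add: left_diff_distrib coeff_monom_mult)

text \<open>For n \<ge> 1 the exponent n + q exceeds the degree of D, which makes the coefficients
  of k at n and n + q congruent. Those beyond the degree of k vanish, and the claim descends from
  there: modulo p, k is a constant.\<close>

lemma X_power_minus_one_multiple_small:
  fixes k D :: "int poly" and p :: int
  assumes q: "q > 0" and D: "degree D \<le> q" "[:p:] dvd D - (monom 1 q - 1) * k" and n: "n \<ge> 1"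
  shows "p dvd coeff k n"
  using n
proof (induction "Suc (degree k) - n" arbitrary: n rule: less_induct)
  case less
  show ?case
  proof (cases "n > degree k")
    case False
    then have "p dvd coeff k (n + q)" using q less by auto
    moreover have "p dvd coeff (D - (monom 1 q - 1) * k) (n + q)"
      using D(2) by (simp add: const_poly_dvd_iff)
    moreover have "coeff D (n + q) = 0" using D(1) less.prems by (intro coeff_eq_0) simp
    ultimately show ?thesis
      using coeff_X_power_minus_one_mult(1)[OF q, of k n] by (simp add: dvd_diff_commute) (metis dvd_diffD dvd_add_left_iff diff_add_cancel)
  qed (simp add: coeff_eq_0)
qed

text \<open>As \<open>X (f g)' = q X\<^sup>q = 1\<close> modulo \<open>f g\<close>, the polynomials \<open>X f' g\<close> and \<open>T + 1\<close> agree modulo \<open>f\<close>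
  and modulo \<open>g\<close>, hence \<open>X f' g = T + X\<^sup>q\<close> over \<open>F\<^sub>p\<close>. Since 1 is a residue, the linear coefficient
  \<open>f'(0) g(0)\<close> of this polynomial vanishes.\<close>

lemma factor_without_linear_term:
  fixes p q :: nat
  assumes p: "Factorial_Ring.prime p" and q: "Factorial_Ring.prime q" "4 * p dvd q - 1"
  obtains f g :: "int poly"
  where "[:int p:] dvd f * g - (monom 1 q - 1)" "lead_coeff f = 1"
    "0 < degree f" "degree f < q" "int p dvd coeff f 1" "int p dvd coeff g 1"
proof -
  have q1: "q > 1" using q(1) by (rule prime_gt_1_nat)
  have q2: "q > 2"
  proof (rule ccontr)
    assume "\<not> q > 2"
    then have "q = 2" using q1 by simp
    then show False using q(2) by auto
  qed
  define T where "T = nonresidue_poly q"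
  define M :: "int poly" where "M = monom 1 q - 1"
  define P where "P = [:int p:]"
  have M: "degree M = q" "lead_coeff M = 1"
  proof -
    show "degree M = q"
      unfolding M_def using q1 by (simp add: diff_conv_add_uminus degree_add_eq_left degree_monom_eq del: add_uminus_conv_diff)
    then show "lead_coeff M = 1" using q1 by (simp add: M_def)
  qed
  have primeP: "prime_elem P"
    unfolding P_def using p by (simp add: prime_elem_const_poly_iff)
  \<comment> \<open>Modulo p this is the ideal generated by T and X^q - 1, so \<open>f\<close> below
    lifts their gcd.\<close>
  define I where "I = {u * T + v * M + w * P | u v w. True}"
  have TI: "T \<in> I" unfolding I_def by (rule CollectI, rule exI[of _ 1], rule exI[of _ 0], rule exI[of _ 0]) simp
  have MI: "M \<in> I" unfolding I_def by (rule CollectI, rule exI[of _ 0], rule exI[of _ 1], rule exI[of _ 0]) simp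
  have PI: "P \<in> I" unfolding I_def by (rule CollectI, rule exI[of _ 0], rule exI[of _ 0], rule exI[of _ 1]) simp
  have add: "a + b \<in> I" if "a \<in> I" "b \<in> I" for a b
  proof -
    from that obtain u v w u' v' w' where "a = u * T + v * M + w * P" "b = u' * T + v' * M + w' * P"
      unfolding I_def by blast
    then have "a + b = (u + u') * T + (v + v') * M + (w + w') * P" by (simp add: algebra_simps)
    then show ?thesis unfolding I_def by blast
  qed
  have mult: "r * a \<in> I" if "a \<in> I" for r a
  proof -
    from that obtain u v w where "a = u * T + v * M + w * P" unfolding I_def by blast
    then have "r * a = (r * u) * T + (r * v) * M + (r * w) * P" by (simp add: algebra_simps)
    then show ?thesis unfolding I_def by blast
  qed
  obtain f where f: "f \<in> I" "lead_coeff f = 1" "degree f \<le> q"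
    and small: "\<And>h. h \<in> I \<Longrightarrow> degree h < degree f \<Longrightarrow> P dvd h"
    using monic_generator_mod_prime[of "int p" I M] p add mult PI MI M unfolding P_def by auto
  have f0: "f \<noteq> 0" using f(2) by auto
  have Pf: "\<not> P dvd f"
  proof
    assume "P dvd f"
    then have "int p dvd 1" using f(2) by (metis P_def const_poly_dvd_iff)
    then show False using p by simp
  qed
  have divI: "\<exists>a r. h = f * a + r \<and> P dvd r \<and> (r = 0 \<or> degree r < degree f)" if "h \<in> I" for h
  proof -
    obtain a r where ar: "h = f * a + r" "r = 0 \<or> degree r < degree f"
      using monic_division[OF f(2)] by blast
    have "r = h + (- a) * f" using ar(1) by simp
    then have "r \<in> I" using that f(1) add mult by metis
    then show ?thesis using ar small by auto
  qed
  obtain a r where "T = f * a + r" "P dvd r" using divI[OF TI] by blast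
  then have a: "P dvd T - f * a" by simp
  obtain g r where gr: "M = f * g + r" "P dvd r" "r = 0 \<or> degree r < degree f" using divI[OF MI] by blast
  have g0: "g \<noteq> 0" using gr f(3) M by auto
  have fg: "P dvd f * g - M" using gr(1,2) by simp
  obtain w0 where w0: "P dvd T * (T + 1) - M * w0"
    using nonresidue_poly_square[OF q(1) q2 q(2)] unfolding T_def M_def P_def by blast
  obtain b where b: "P dvd (T + 1) - g * b"
  proof -
    obtain u v w where uvw: "f = u * T + v * M + w * P" using f(1) unfolding I_def by blast
    \<comment> \<open>Multiplying the Bezout relation for f by T + 1 gives f (T + 1) = M b = f g b
      modulo p, and f cancels because p is a prime element of Z[X].\<close>
    define b where "b = u * w0 + v * (T + 1)"
    have fT: "f * (T + 1) = u * T * (T + 1) + v * M * (T + 1) + w * P * (T + 1)"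
      using arg_cong[OF uvw, of "\<lambda>h. h * (T + 1)"] by (simp only: distrib_right)
    have "f * ((T + 1) - g * b) = f * (T + 1) - f * g * b"
      by (simp add: algebra_simps)
    also have "\<dots> = u * (T * (T + 1) - M * w0) + w * (T + 1) * P - (f * g - M) * b"
      unfolding fT by (simp add: b_def algebra_simps)
    finally have "f * ((T + 1) - g * b)
        = u * (T * (T + 1) - M * w0) + w * (T + 1) * P - (f * g - M) * b" .
    then have "P dvd f * ((T + 1) - g * b)"
      using w0 fg by simp
    then have "P dvd (T + 1) - g * b" using primeP Pf prime_elem_dvd_mult_iff by blast
    then show ?thesis using that by blast
  qed
  define D where "D = [:0, 1:] * pderiv f * g - (T + monom 1 q)"
  obtain k where k: "P dvd D - M * k"
  proof -
    \<comment> \<open>As q = 1 modulo p, the term q X^q of X (X^q - 1)' may be replaced by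
      X^q.\<close>
    have qP: "P dvd monom (int q - 1) q"
    proof -
      have "p dvd q - 1" using q(2) by (rule dvd_mult_right)
      then have "int p dvd int q - 1" using q1 by (metis int_dvd_int_iff of_nat_1 of_nat_diff less_imp_le_nat)
      then show ?thesis by (simp add: P_def const_poly_dvd_iff)
    qed
    have "P dvd pderiv (f * g - M)"
      using fg by (simp add: P_def const_poly_dvd_iff coeff_pderiv)
    then have "P dvd pderiv f * g + f * pderiv g - pderiv M"
      by (simp add: pderiv_mult pderiv_diff algebra_simps)
    then have der: "P dvd [:0, 1:] * (pderiv f * g + f * pderiv g - pderiv M)"
      by (rule dvd_mult)
    have derM: "[:0, 1:] * pderiv M = monom (int q - 1) q + monom 1 q"
      using q1 by (simp add: M_def pderiv_diff pderiv_monom add_monom monom_Suc[symmetric])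
    define e where "e = [:0, 1:] * (pderiv f * g + f * pderiv g - pderiv M) + monom (int q - 1) q"
    have Pe: "P dvd e" using der qP unfolding e_def by (rule dvd_add)
    define x where "x = a + [:0, 1:] * pderiv g"
    define y where "y = [:0, 1:] * pderiv f - b"
    have Df: "D = e - (T - f * a) - f * x"
      unfolding D_def e_def x_def right_diff_distrib[of _ _ "pderiv M"] derM by (simp add: algebra_simps)
    have Dg: "D = g * y - ((T + 1) - g * b) - M"
      unfolding D_def y_def by (simp add: M_def algebra_simps)
    have Df': "P dvd D + f * x" using Df Pe a by simp
    have Dg': "P dvd D - g * y + f * g"
    proof -
      have "D - g * y + f * g = (f * g - M) - ((T + 1) - g * b)" using Dg by simp
      then show ?thesis using dvd_diff[OF fg b] by (simp only:)
    qed
    \<comment> \<open>Modulo p, g b - f a = (T + 1) - T = 1. Multiplying D by this and inserting D =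
      - f x in the first term and D = g (y - f) in the second yields D = f g k.\<close>
    define k where "k = b * (- x) - a * (y - f)"
    have Dk: "D - M * k = (D + f * x) * (g * b) - (D - g * y + f * g) * (f * a)
        + D * (((T + 1) - g * b) - (T - f * a)) + (f * g - M) * k"
      unfolding k_def by (simp add: algebra_simps)
    have "P dvd D - M * k"
      unfolding Dk by (intro dvd_add dvd_diff dvd_mult2[OF Df'] dvd_mult2[OF Dg']
          dvd_mult[OF dvd_diff[OF b a]] dvd_mult2[OF fg])
    then show ?thesis using that by blast
  qed
  have coeffT: "coeff T n = (if n < q then nonresidue (int q) (int n) else 0)" for n
    by (simp add: T_def coeff_nonresidue_poly)
  have T1: "coeff T 1 = 0" and T0: "coeff T 0 = 0"
    using q1 Legendre_one[of "int q"] by (simp_all add: coeffT nonresidue_def Legendre_def cong_def)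
  have degD: "degree D \<le> q"
  proof -
    have "degree (f * g) = q"
    proof -
      have "degree (f * g) = degree (M - r)" using gr(1) by simp
      also have "\<dots> = q"
        using gr(3) f(3) M by (auto simp: diff_conv_add_uminus degree_add_eq_left simp del: add_uminus_conv_diff)
      finally show ?thesis .
    qed
    then have "degree f + degree g = q" using f0 g0 by (simp add: degree_mult_eq)
    moreover have "degree (pderiv f * g) \<le> degree (pderiv f) + degree g" by (rule degree_mult_le)
    moreover have "degree ([:0, 1:] * (pderiv f * g)) \<le> 1 + degree (pderiv f * g)"
      using degree_mult_le[of "[:0, 1:]" "pderiv f * g"] by simp
    moreover have "degree (pderiv f) = degree f - 1" by (rule degree_pderiv)
    \<comment> \<open>The subtraction in the degree of the derivative is truncated for constant f;
      there the whole product vanishes.\<close>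
    moreover have "pderiv f = 0" if "degree f = 0" using that by (simp add: pderiv_eq_0_iff)
    ultimately have "degree ([:0, 1:] * (pderiv f * g)) \<le> q"
      by (cases "degree f = 0") auto
    moreover have "degree T \<le> q" by (rule degree_le) (simp add: coeffT)
    ultimately show ?thesis
      unfolding D_def mult.assoc by (intro degree_diff_le degree_add_le degree_monom_le) auto
  qed
  \<comment> \<open>Since q > 1, it follows that (X^q - 1) k has no linear term modulo p.\<close>
  have kn: "int p dvd coeff k n" if "n \<ge> 1" for n
    by (rule X_power_minus_one_multiple_small[OF _ degD]) (use q1 k that in \<open>auto simp: M_def P_def\<close>)
  have Dk: "int p dvd coeff D n - coeff (M * k) n" for n
    using k by (simp add: P_def const_poly_dvd_iff)
  have D1: "coeff D 1 = coeff f 1 * coeff g 0"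
    unfolding D_def using q1 T1 by (simp add: coeff_mult_0 coeff_pderiv mult.assoc)
  have fgc: "int p dvd coeff (f * g) n - coeff M n" for n
    using fg by (simp add: P_def const_poly_dvd_iff)
  have fg0: "int p dvd coeff f 0 * coeff g 0 + 1"
    using fgc[of 0] q1 by (simp add: M_def coeff_mult_0)
  have pp: "Factorial_Ring.prime (int p)" using p by simp
  have "int p dvd coeff f 1 * coeff g 0"
    using Dk[of 1] kn[of 1] coeff_X_power_minus_one_mult(2)[of q 1 k] q1
    by (simp add: D1[simplified] M_def dvd_add_left_iff)
  moreover have "\<not> int p dvd coeff g 0" "\<not> int p dvd coeff f 0"
    using fg0 pp by (auto simp: dvd_add_right_iff)
  ultimately have f1: "int p dvd coeff f 1"
    using pp prime_dvd_mult_iff by blast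
  have g1: "int p dvd coeff g 1"
  proof -
    have "coeff (f * g) 1 = coeff f 0 * coeff g 1 + coeff f 1 * coeff g 0"
      by (simp add: coeff_mult)
    then have "int p dvd coeff f 0 * coeff g 1 + coeff f 1 * coeff g 0"
      using fgc[of 1] q1 by (simp add: M_def)
    then have "int p dvd coeff f 0 * coeff g 1"
      using f1 by (metis dvd_add_left_iff dvd_mult2)
    then show ?thesis using pp \<open>\<not> int p dvd coeff f 0\<close> prime_dvd_mult_iff by blast
  qed
  \<comment> \<open>For constant f, D is -(T + X^q). Its constant term 0 forces k(0) = 0 modulo p,
    while its coefficient -1 at X^q forces k(0) = -1.\<close>
  have "degree f \<noteq> 0"
  proof
    assume "degree f = 0"
    then have "pderiv f = 0" by (simp add: pderiv_eq_0_iff)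
    then have D: "coeff D 0 = 0" "coeff D q = -1" unfolding D_def using q1 T0 by (simp_all add: coeffT)
    have "int p dvd coeff k 0"
      using Dk[of 0] coeff_X_power_minus_one_mult(2)[of q 0 k] q1 D by (simp add: M_def)
    moreover have "int p dvd coeff k q" using kn[of q] q1 by simp
    ultimately have "int p dvd coeff k 0 - coeff k q" by (rule dvd_diff)
    moreover have "int p dvd - 1 - (coeff k 0 - coeff k q)"
      using Dk[of q] coeff_X_power_minus_one_mult(1)[of q k 0] q1 D by (simp add: M_def)
    ultimately have "int p dvd - 1 - (coeff k 0 - coeff k q) + (coeff k 0 - coeff k q)"
      by (rule dvd_add[rotated])
    then show False using p by simp
  qed
  \<comment> \<open>Otherwise T, an element of I of degree below q, would be divisible by p,
    although its coefficient at a nonresidue is 1.\<close>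
  moreover have "degree f \<noteq> q"
  proof
    assume "degree f = q"
    obtain u where u: "Legendre u (int q) = - 1" using Legendre_nonresidue_exists[OF q(1) q2] by blast
    have "degree T < q"
    proof -
      have "degree T \<le> q - 1" by (rule degree_le) (auto simp: coeffT)
      then show ?thesis using q1 by simp
    qed
    then have "P dvd T" using small[OF TI] \<open>degree f = q\<close> by simp
    then have "int p dvd coeff T (nat (u mod int q))" by (simp add: P_def const_poly_dvd_iff)
    moreover have "coeff T (nat (u mod int q)) = 1"
      using q1 u by (simp add: coeffT nat_less_iff) (simp add: nonresidue_def)
    ultimately show False using p by simp
  qed
  ultimately show thesis
    using that[OF _ f(2) _ _ f1 g1] fg f(3) unfolding P_def M_def by auto
qed


section \<open>Transfer to the monoid ring\<close>

abbreviation M23 :: "('a, 'm) ring_scheme \<Rightarrow> (nat \<Rightarrow> 'a) ring" where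
  "M23 F \<equiv> monoid_ring F monoid_2_3"

lemma carrier_M23:
  "f \<in> carrier (M23 F) \<longleftrightarrow> range f \<subseteq> carrier F \<and> finite {a. f a \<noteq> \<zero>\<^bsub>F\<^esub>} \<and> f 1 = \<zero>\<^bsub>F\<^esub>"
  by (auto simp: monoid_ring_def carrier_monoid_2_3)

context field
begin

lemma monoid_ring_uminus:
  assumes "f \<in> carrier (M23 R)"
  shows "\<ominus>\<^bsub>M23 R\<^esub> f = (\<lambda>a. \<ominus> f a)"
  unfolding a_inv_def[of "M23 R"] m_inv_def
proof (rule the_equality, goal_cases)
  case 1
  have c: "f a \<in> carrier R" for a using assms by (auto simp: carrier_M23)
  have "\<ominus> f a = \<zero> \<longleftrightarrow> f a = \<zero>" for a using c by (rule add.inv_eq_1_iff)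
  then have "(\<lambda>a. \<ominus> f a) \<in> carrier (M23 R)"
    using assms c by (auto simp: carrier_M23)
  moreover have "f \<oplus>\<^bsub>M23 R\<^esub> (\<lambda>a. \<ominus> f a) = \<zero>\<^bsub>M23 R\<^esub>" "(\<lambda>a. \<ominus> f a) \<oplus>\<^bsub>M23 R\<^esub> f = \<zero>\<^bsub>M23 R\<^esub>"
    using c by (simp_all add: monoid_ring_def l_neg r_neg)
  ultimately show ?case by simp
next
  case (2 g)
  then have g: "g \<in> carrier (M23 R)" "g \<oplus>\<^bsub>M23 R\<^esub> f = \<zero>\<^bsub>M23 R\<^esub>" by simp_all
  show ?case
  proof
    fix a
    have "f a \<in> carrier R" "g a \<in> carrier R" using assms g(1) by (auto simp: carrier_M23)
    moreover have "g a \<oplus> f a = \<zero>" using g(2) by (simp add: monoid_ring_def fun_eq_iff)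
    ultimately show "g a = \<ominus> f a" by (simp add: minus_equality)
  qed
qed

lemma X_power_minus_one_M23:
  assumes "q > 1"
  shows "X_power_minus_one R monoid_2_3 q = (\<lambda>a. if a = q then \<one> else if a = 0 then \<ominus> \<one> else \<zero>)"
proof -
  have "\<one>\<^bsub>M23 R\<^esub> \<in> carrier (M23 R)"
    by (auto simp: carrier_M23) (auto simp: monoid_ring_def monoid_2_3_def)
  then have "X_power_minus_one R monoid_2_3 q = (\<lambda>a. X_power R q a \<oplus> \<ominus> (\<one>\<^bsub>M23 R\<^esub> a))"
    unfolding X_power_minus_one_def a_minus_def monoid_ring_uminus[OF \<open>\<one>\<^bsub>M23 R\<^esub> \<in> carrier (M23 R)\<close>]
    by (simp add: monoid_ring_def)
  also have "\<dots> = (\<lambda>a. if a = q then \<one> else if a = 0 then \<ominus> \<one> else \<zero>)"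
    using assms by (auto simp: X_power_def monoid_ring_def monoid_2_3_def)
  finally show ?thesis .
qed

section \<open>Products, units and proper factors in the monoid ring\<close>

lemma M23_mult:
  assumes f: "f \<in> carrier (M23 R)" and g: "g \<in> carrier (M23 R)"
  shows "(f \<otimes>\<^bsub>M23 R\<^esub> g) n = (\<Oplus>i\<in>{..n}. f i \<otimes> g (n - i))"
proof -
  have carr: "f i \<in> carrier R" "g i \<in> carrier R" for i
    using f g by (auto simp: carrier_M23)
  let ?A = "{(a, b). f a \<noteq> \<zero> \<and> g b \<noteq> \<zero> \<and> a \<otimes>\<^bsub>monoid_2_3\<^esub> b = n}"
  let ?B = "(\<lambda>i. (i, n - i)) ` {..n}"
  have "?A \<subseteq> ?B" by (auto simp: monoid_2_3_def image_iff)
  have "(f \<otimes>\<^bsub>M23 R\<^esub> g) n = finsum R (\<lambda>(a, b). f a \<otimes> g b) ?A"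
    by (simp add: monoid_ring_def)
  also have "\<dots> = finsum R (\<lambda>(a, b). f a \<otimes> g b) ?B"
  proof (rule add.finprod_mono_neutral_cong_left)
    show "(case x of (a, b) \<Rightarrow> f a \<otimes> g b) = \<zero>" if "x \<in> ?B - ?A" for x
      using that carr by (auto simp: monoid_2_3_def)
  qed (use \<open>?A \<subseteq> ?B\<close> carr in auto)
  also have "\<dots> = (\<Oplus>i\<in>{..n}. f i \<otimes> g (n - i))"
    by (subst add.finprod_reindex) (auto simp: carr inj_on_def)
  finally show ?thesis .
qed

lemma M23_mult_leading:
  assumes f: "f \<in> carrier (M23 R)" and g: "g \<in> carrier (M23 R)"
    and m: "f m \<noteq> \<zero>" "\<And>i. i > m \<Longrightarrow> f i = \<zero>" and n: "g n \<noteq> \<zero>" "\<And>i. i > n \<Longrightarrow> g i = \<zero>"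
  shows "(f \<otimes>\<^bsub>M23 R\<^esub> g) (m + n) \<noteq> \<zero>"
proof -
  have carr: "f i \<in> carrier R" "g i \<in> carrier R" for i
    using f g by (auto simp: carrier_M23)
  have "(f \<otimes>\<^bsub>M23 R\<^esub> g) (m + n) = (\<Oplus>i\<in>{..m + n}. if m = i then f i \<otimes> g n else \<zero>)"
    unfolding M23_mult[OF f g]
  proof (rule add.finprod_cong')
    \<comment> \<open>An index i \<noteq> m has i > m or m + n - i > n, so one of the two factors
      vanishes.\<close>
    fix i assume "i \<in> {..m + n}"
    show "f i \<otimes> g (m + n - i) = (if m = i then f i \<otimes> g n else \<zero>)"
      using m(2)[of i] n(2)[of "m + n - i"] carr by (cases i m rule: linorder_cases) auto
  qed (use carr in auto)
  also have "\<dots> = f m \<otimes> g n"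
    by (rule add.finprod_singleton) (use carr in auto)
  finally show ?thesis using m(1) n(1) carr integral_iff by auto
qed

lemma M23_top:
  assumes "f \<in> carrier (M23 R)" "f i \<noteq> \<zero>"
  obtains m where "i \<le> m" "f m \<noteq> \<zero>" "\<And>j. j > m \<Longrightarrow> f j = \<zero>"
proof -
  have fin: "finite {a. f a \<noteq> \<zero>}" using assms(1) by (simp add: carrier_M23)
  let ?m = "Max {a. f a \<noteq> \<zero>}"
  have "?m \<in> {a. f a \<noteq> \<zero>}" by (rule Max_in) (use fin assms(2) in auto)
  moreover have le: "j \<le> ?m" if "f j \<noteq> \<zero>" for j using fin that by (simp add: Max_ge)
  have "f j = \<zero>" if "j > ?m" for j using le[of j] that by (auto simp only: not_le[symmetric])
  ultimately show thesis using that[of ?m] le[OF assms(2)] by blast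
qed

text \<open>A form of deg (f g) \<ge> deg f for coefficient functions. It shows both that
  nonconstant elements are not units and that X^q - 1 divides no nonzero element of smaller
  degree.\<close>

lemma M23_mult_nonzero_beyond:
  assumes f: "f \<in> carrier (M23 R)" and g: "g \<in> carrier (M23 R)" and i: "f i \<noteq> \<zero>" and g0: "g \<noteq> (\<lambda>_. \<zero>)"
  shows "\<exists>j\<ge>i. (f \<otimes>\<^bsub>M23 R\<^esub> g) j \<noteq> \<zero>"
proof -
  obtain k where "g k \<noteq> \<zero>" using g0 by auto
  obtain m where m: "i \<le> m" "f m \<noteq> \<zero>" "\<And>j. j > m \<Longrightarrow> f j = \<zero>" using M23_top[OF f i] by blast
  obtain n where n: "g n \<noteq> \<zero>" "\<And>j. j > n \<Longrightarrow> g j = \<zero>" using M23_top[OF g \<open>g k \<noteq> \<zero>\<close>] by blast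
  show ?thesis using M23_mult_leading[OF f g m(2,3) n] m(1) by (intro exI[of _ "m + n"]) auto
qed

lemma M23_mult_zero:
  "(f \<otimes>\<^bsub>M23 R\<^esub> (\<lambda>_. \<zero>)) = (\<lambda>_. \<zero>)"
  by (auto simp: monoid_ring_def)

lemma M23_nonunit:
  assumes f: "f i \<noteq> \<zero>" "i > 0"
  shows "f \<notin> Units (M23 R)"
proof
  assume "f \<in> Units (M23 R)"
  then obtain g where fg: "f \<in> carrier (M23 R)" "g \<in> carrier (M23 R)" "f \<otimes>\<^bsub>M23 R\<^esub> g = \<one>\<^bsub>M23 R\<^esub>"
    unfolding Units_def by blast
  have one: "\<one>\<^bsub>M23 R\<^esub> = (\<lambda>a. if a = 0 then \<one> else \<zero>)"
    by (simp add: monoid_ring_def monoid_2_3_def)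
  have "g \<noteq> (\<lambda>_. \<zero>)"
  proof
    assume "g = (\<lambda>_. \<zero>)"
    then have "\<one>\<^bsub>M23 R\<^esub> = (\<lambda>_. \<zero>)" using fg M23_mult_zero by metis
    then show False unfolding one by (metis one_not_zero)
  qed
  then show False
    using M23_mult_nonzero_beyond[OF fg(1,2) f(1)] f(2) by (auto simp: fg(3) one)
qed

text \<open>An irreducible element has only units as proper factors. Here f is nonconstant, hence
  not a unit, and it is a proper factor because its degree is below q.\<close>

lemma X_power_minus_one_reducibleI:
  assumes q: "q > 1" and f: "f \<in> carrier (M23 R)" and g: "g \<in> carrier (M23 R)"
    and fg: "f \<otimes>\<^bsub>M23 R\<^esub> g = X_power_minus_one R monoid_2_3 q"
    and d: "f d \<noteq> \<zero>" "0 < d" "\<And>i. i \<ge> q \<Longrightarrow> f i = \<zero>"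
  shows "reducible (M23 R) (X_power_minus_one R monoid_2_3 q)"
proof -
  let ?r = "X_power_minus_one R monoid_2_3 q"
  note r = X_power_minus_one_M23[OF q]
  have rq: "?r q \<noteq> \<zero>" by (simp add: r)
  have rc: "?r \<in> carrier (M23 R)"
    using q unfolding r carrier_M23 by (auto intro!: finite_subset[of _ "{q, 0}"])
  have "f divides\<^bsub>M23 R\<^esub> ?r" unfolding factor_def using g fg by metis
  moreover have "\<not> ?r divides\<^bsub>M23 R\<^esub> f"
  proof
    assume "?r divides\<^bsub>M23 R\<^esub> f"
    then obtain h where h: "h \<in> carrier (M23 R)" "f = ?r \<otimes>\<^bsub>M23 R\<^esub> h" unfolding factor_def by blast
    have "h \<noteq> (\<lambda>_. \<zero>)" using h(2) M23_mult_zero d(1) by metis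
    then show False using M23_mult_nonzero_beyond[OF rc h(1) rq] d(3) h(2) by metis
  qed
  ultimately have "properfactor (M23 R) f ?r" unfolding properfactor_def by blast
  then have "\<not> ring_irreducible\<^bsub>M23 R\<^esub> ?r"
    unfolding ring_irreducible_def irreducible_def using f M23_nonunit[of f d] d by blast
  then show ?thesis
    unfolding reducible_def using rc M23_nonunit[of ?r q, OF rq] q by simp
qed

section \<open>Reduction of integer polynomials to a field of characteristic p\<close>

definition of_integer :: "int \<Rightarrow> 'a" where
  "of_integer n = add_pow R n \<one>"

lemma of_integer_closed [simp]: "of_integer n \<in> carrier R"
  by (simp add: of_integer_def)

lemma of_integer_add: "of_integer (m + n) = of_integer m \<oplus> of_integer n"
  by (simp add: of_integer_def add.int_pow_mult)

lemma of_integer_mult: "of_integer (m * n) = of_integer m \<otimes> of_integer n"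
  by (simp add: of_integer_def add_pow_ldistr_int add.int_pow_pow mult.commute)

lemma of_integer_minus: "of_integer (- n) = \<ominus> of_integer n"
  by (simp add: of_integer_def add.int_pow_neg)

lemma of_integer_one [simp]: "of_integer 1 = \<one>"
  by (simp add: of_integer_def)

lemma of_integer_zero [simp]: "of_integer 0 = \<zero>"
  using of_integer_add[of 0 0] by simp

lemma of_integer_sum: "finite A \<Longrightarrow> of_integer (\<Sum>i\<in>A. h i) = (\<Oplus>i\<in>A. of_integer (h i))"
  by (induction A rule: finite_induct) (simp_all add: of_integer_add Pi_def)

lemma of_integer_eq_zero_iff:
  assumes "has_characteristic R p"
  shows "of_integer n = \<zero> \<longleftrightarrow> int p dvd n"
proof -
  have nat: "of_integer (int k) = \<zero> \<longleftrightarrow> p dvd k" for k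
    using assms by (simp add: has_characteristic_def of_integer_def add_pow_int_ge)
  show ?thesis
  proof (cases "n \<ge> 0")
    case True
    then show ?thesis using nat[of "nat n"] by (simp flip: int_dvd_int_iff)
  next
    case False
    then have "of_integer n = \<ominus> of_integer (int (nat (- n)))"
      by (simp flip: of_integer_minus)
    then show ?thesis using nat[of "nat (- n)"] False
      by (simp flip: int_dvd_int_iff)
  qed
qed

lemma of_integer_cong:
  assumes "has_characteristic R p" "int p dvd m - n"
  shows "of_integer m = of_integer n"
proof -
  have "of_integer m = of_integer (m - n) \<oplus> of_integer n"
    by (simp flip: of_integer_add)
  then show ?thesis using assms by (simp add: of_integer_eq_zero_iff)
qed

text \<open>The two linear coefficients reduce to zero, which places the images of f and g in the
  monoid ring; f is monic, so its degree survives reduction.\<close>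

lemma X_power_minus_one_reducible_of_int_poly:
  fixes f g :: "int poly"
  assumes char: "has_characteristic R p"
    and q: "q > 1" and fg: "[:int p:] dvd f * g - (Polynomial.monom 1 q - 1)"
    and f: "Polynomial.lead_coeff f = 1" "0 < Polynomial.degree f" "Polynomial.degree f < q"
    and lin: "int p dvd Polynomial.coeff f 1" "int p dvd Polynomial.coeff g 1"
  shows "reducible (M23 R) (X_power_minus_one R monoid_2_3 q)"
proof -
  define \<phi> where "\<phi> h i = of_integer (Polynomial.coeff h i)" for h :: "int poly" and i
  have carr: "\<phi> h \<in> carrier (M23 R)" if "int p dvd Polynomial.coeff h 1" for h
  proof -
    have "{a. \<phi> h a \<noteq> \<zero>} \<subseteq> {..Polynomial.degree h}"
      unfolding \<phi>_def using coeff_eq_0[of h] by (auto simp: not_le intro!: le_degree)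
    then have "finite {a. \<phi> h a \<noteq> \<zero>}" by (rule finite_subset) simp
    then show ?thesis
      using that char by (auto simp: carrier_M23 \<phi>_def of_integer_eq_zero_iff)
  qed
  show ?thesis
  proof (rule X_power_minus_one_reducibleI[OF q carr[OF lin(1)] carr[OF lin(2)]])
    show "\<phi> f \<otimes>\<^bsub>M23 R\<^esub> \<phi> g = X_power_minus_one R monoid_2_3 q"
    proof
      fix n
      have "(\<phi> f \<otimes>\<^bsub>M23 R\<^esub> \<phi> g) n = of_integer (Polynomial.coeff (f * g) n)"
        unfolding M23_mult[OF carr[OF lin(1)] carr[OF lin(2)]]
        by (simp add: \<phi>_def coeff_mult of_integer_sum of_integer_mult)
      also have "\<dots> = of_integer (Polynomial.coeff (Polynomial.monom 1 q - 1 :: int poly) n)"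
        by (rule of_integer_cong[OF char]) (use fg in \<open>simp add: const_poly_dvd_iff\<close>)
      also have "\<dots> = X_power_minus_one R monoid_2_3 q n"
        using q by (auto simp: X_power_minus_one_M23 of_integer_minus)
      finally show "(\<phi> f \<otimes>\<^bsub>M23 R\<^esub> \<phi> g) n = X_power_minus_one R monoid_2_3 q n" .
    qed
    show "\<phi> f (Polynomial.degree f) \<noteq> \<zero>" by (simp add: \<phi>_def f)
    show "\<phi> f i = \<zero>" if "i \<ge> q" for i using that f(3) by (simp add: \<phi>_def coeff_eq_0)
  qed (rule f)
qed

end

lemma (in field) X_power_minus_one_reducible:
  assumes p: "Factorial_Ring.prime p" and char: "has_characteristic R p"
    and q: "Factorial_Ring.prime q" "4 * p dvd q - 1"
  shows "reducible (M23 R) (X_power_minus_one R monoid_2_3 q)"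
proof -
  obtain f g :: "int poly" where "[:int p:] dvd f * g - (Polynomial.monom 1 q - 1)" "Polynomial.lead_coeff f = 1"
    "0 < Polynomial.degree f" "Polynomial.degree f < q"
    "int p dvd Polynomial.coeff f 1" "int p dvd Polynomial.coeff g 1"
    using factor_without_linear_term[OF p q] .
  then show ?thesis
    using prime_gt_1_nat[OF q(1)] by (intro X_power_minus_one_reducible_of_int_poly[OF char])
qed

section \<open>The residue field, its copies and the failure of the Matsuda property\<close>

lemma residue_ring_has_characteristic:
  assumes "p > 1"
  shows "has_characteristic (residue_ring (int p)) p"
proof -
  have "add_pow (residue_ring (int p)) n \<one>\<^bsub>residue_ring (int p)\<^esub> = int n mod int p" for n :: nat
  proof (induction n)
    case (Suc n)
    then show ?case
      by (simp add: add_pow_def nat_pow_def) (simp add: residue_ring_def mod_simps add.commute)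
  qed (simp add: add_pow_def nat_pow_def, simp add: residue_ring_def)
  then show ?thesis
    unfolding has_characteristic_def
    by (simp add: residue_ring_def mod_eq_0_iff_dvd)
qed

lemma (in ring) image_ring_has_characteristic:
  assumes inj: "inj_on h (carrier R)" and char: "has_characteristic R p"
  shows "has_characteristic (image_ring h R) p"
proof -
  have "add_pow (image_ring h R) n \<one>\<^bsub>image_ring h R\<^esub> = h (add_pow R n \<one>)" for n :: nat
  proof (induction n)
    case (Suc n)
    have "add_pow (image_ring h R) (Suc n) \<one>\<^bsub>image_ring h R\<^esub>
        = add_pow (image_ring h R) n \<one>\<^bsub>image_ring h R\<^esub> \<oplus>\<^bsub>image_ring h R\<^esub> \<one>\<^bsub>image_ring h R\<^esub>"
      by (simp add: add_pow_def nat_pow_def)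
    also have "\<dots> = h (add_pow R n \<one>) \<oplus>\<^bsub>image_ring h R\<^esub> h \<one>"
      by (simp only: Suc[unfolded image_ring_one] image_ring_one)
    also have "\<dots> = h (add_pow R n \<one> \<oplus> \<one>)"
      using inj by (simp add: image_ring_def image_group_def monoid.defs)
    finally show ?case by simp
  qed (simp add: add_pow_def nat_pow_def image_ring_zero)
  then show ?thesis
    using char inj_on_eq_iff[OF inj] by (simp add: has_characteristic_def image_ring_zero)
qed

text \<open>The only other decomposition of q as a multiple, q times 1, is excluded because 1 is not
  in the monoid.\<close>

lemma prime_indivisible_monoid_2_3:
  assumes "Factorial_Ring.prime q"
  shows "indivisible monoid_2_3 q"
  unfolding indivisible_def carrier_monoid_2_3
proof (intro conjI allI ballI impI)
  show "q \<in> - {1}" using assms prime_gt_1_nat[of q] by auto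
  fix n x :: nat assume nx: "x \<in> - {1}" "0 < n \<and> x [^]\<^bsub>monoid_2_3\<^esub> n = q"
  have "x [^]\<^bsub>monoid_2_3\<^esub> n = n * x" by (induction n) (simp_all add: nat_pow_def monoid_2_3_def)
  with nx have q: "q = n * x" by simp
  with nx assms show "n = 1" by (metis ComplD insertI1 prime_product)
  with q show "x = q" by simp
qed

theorem corollary1:
  assumes GRH: "\<And>p n :: nat. Factorial_Ring.prime p \<Longrightarrow> squarefree n \<Longrightarrow>
      satisfies_GRH (dedekind_zeta (radical_field n p)) \<and>
      satisfies_GRH (dedekind_zeta (radical_field (4 * n) p))"
  shows "(\<forall>p :: nat. Factorial_Ring.prime p \<longrightarrow> infinite (E p)) \<and>
      (\<forall>p :: nat. Factorial_Ring.prime p \<longrightarrow> \<not> matsuda_monoid TYPE('k :: infinite) p monoid_2_3)"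
proof (intro conjI allI impI)
  fix p :: nat
  assume p: "Factorial_Ring.prime p"
  interpret R: residues_prime p "residue_ring (int p)"
    using p by unfold_locales
  have char: "has_characteristic (residue_ring (int p)) p"
    using p by (intro residue_ring_has_characteristic prime_gt_1_nat)
  note red = field.X_power_minus_one_reducible[OF _ p]
  have "{q. Factorial_Ring.prime q \<and> 4 * p dvd q - 1} \<subseteq> E p"
    using red[OF R.is_field char] by (auto simp: E_def)
  then show "infinite (E p)"
    using infinite_primes_one_mod_four_mult[OF p] finite_subset by blast
  show "\<not> matsuda_monoid TYPE('k :: infinite) p monoid_2_3"
  proof
    assume matsuda: "matsuda_monoid TYPE('k) p monoid_2_3"
    \<comment> \<open>The type is infinite, so it contains p elements onto which the field structure
      of F_p can be transported.\<close>
    obtain K :: "'k set" where "finite K" "card K = card {0..int p - 1}"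
      using infinite_arbitrarily_large[OF infinite_UNIV] by blast
    then obtain h where "bij_betw h {0..int p - 1} K"
      using finite_same_card_bij[of "{0..int p - 1}" K] by auto
    then have "inj_on h {0..int p - 1}" by (rule bij_betw_imp_inj_on)
    then have h: "inj_on h (carrier (residue_ring (int p)))" by (simp add: residue_ring_def)
    let ?F = "image_ring h (residue_ring (int p))"
    have F: "field ?F" by (rule R.inj_imp_image_ring_is_field[OF h])
    have charF: "has_characteristic ?F p" by (rule R.image_ring_has_characteristic[OF h char])
    obtain q where q: "Factorial_Ring.prime q" "4 * p dvd q - 1"
      using infinite_primes_one_mod_four_mult[OF p] not_finite_existsD by blast
    have "ring_irreducible\<^bsub>M23 ?F\<^esub> (X_power_minus_one ?F monoid_2_3 q)"
      using matsuda F charF prime_indivisible_monoid_2_3[OF q(1)] unfolding matsuda_monoid_def by blast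
    then show False using red[OF F charF q] unfolding reducible_def by blast
  qed
qed

end
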